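(* Let $\mathcal{F}$ be a $\sigma$-algebra on a set $\Omega$, let $\mathcal{L}^{\infty}$ be the space of bounded $\mathcal{F}$-measurable functions $f:\Omega\to\mathbb{R}$, let $\mathcal{H}\subset\mathcal{L}^{\infty}$ be a set with $\mathbf{1}_{\Omega}\in\mathcal{H}$, let $\pi:\mathcal{H}\to\mathbb{R}$ be coherent, and let $L:\mathrm{span}(\mathcal{H})\to\mathbb{R}$ be its linear extension. Let $g\in\mathcal{L}^{\infty}\setminus\mathrm{span}(\mathcal{H})$, let $g_0\in\mathbb{R}$ be the prevision (price) assigned to $g$, and define $$\underline{\pi}(g)=\sup\{L(f)\mid f\in\mathrm{span}(\mathcal{H}),\ f\le g\},\qquad \overline{\pi}(g)=\inf\{L(f)\mid f\in\mathrm{span}(\mathcal{H}),\ f\ge g\}.$$ Then $g_0$ does not violate coherence in $\mathrm{span}(\mathcal{H}\cup\{g\})$ (that is, the function $f+\alpha g\mapsto L(f)+\alpha g_0$, $f\in\mathrm{span}(\mathcal{H})$, $\alpha\in\mathbb{R}$, is a coherent prevision on $\mathrm{span}(\mathcal{H}\cup\{g\})$) if and only if $g_0$ belongs to the closed interval $[\underline{\pi}(g),\overline{\pi}(g)]$. Furthermore, $$\underline{\pi}(g)=\inf\{E_{\mathfrak{p}}[g]\mid\mathfrak{p}\in\mathcal{M}\},\qquad \overline{\pi}(g)=\sup\{E_{\mathfrak{p}}[g]\mid\mathfrak{p}\in\mathcal{M}\},$$ where $\mathcal{M}=\{\mathfrak{p}\in\mathcal{P}_f\mid E_{\mathfrak{p}}[h]=\pi(h)\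 \text{for all } h\in\mathcal{H}\}$.
   Context: Coherence: for a set $\mathcal{K}\subset\mathcal{L}^{\infty}$, a function $\rho:\mathcal{K}\to\mathbb{R}$ (a prevision) is coherent if for every $n\in\mathbb{N}$, $f_1,\dots,f_n\in\mathcal{K}$ and $\beta_1,\dots,\beta_n\in\mathbb{R}$ one has $\inf_{\omega\in\Omega}\sum_{i=1}^n\beta_i[\rho(f_i)-f_i(\omega)]\le 0$. Linear extension: $\mathrm{span}(\mathcal{H})$ is the linear space generated by $\mathcal{H}$. When $\pi:\mathcal{H}\to\mathbb{R}$ is coherent, there is a (unique) linear functional $L:\mathrm{span}(\mathcal{H})\to\mathbb{R}$ with $L(f)=\pi(f)$ for all $f\in\mathcal{H}$, given by $L(\sum_i\alpha_if_i)=\sum_i\alpha_i\pi(f_i)$ for $f_i\in\mathcal{H}$; it is positive and satisfies $L(\mathbf{1}_\Omega)=1$. Inequalities between functions are pointwise on all of $\Omega$; $\mathbf{1}_A$ is the indicator function of $A$. $\mathcal{P}_f$ is the set of finitely additive probability measures, i.e. set functions $\mathfrak{p}:\mathcal{F}\to\mathbb{R}$ with $\mathfrak{p}(A)\ge 0$ for every $A\in\mathcal{F}$, $\mathfrak{p}(\Omega)=1$, and $\mathfrak{p}(A\cup B)=\mathfrak{p}(A)+\mathfrak{p}(B)$ for all disjoint $A,B\in\mathcal{F}$. For $\mathfrak{p}\in\mathcal{P}_f$ and $f\in\mathcal{L}^{\infty}$, $E_{\mathfrak{p}}[f]=\int_{\Omega}f\,d\mathfrak{p}$ is the integral with respect to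 a finitely additive measure: for an $\mathcal{F}$-measurable simple function $s=\sum_{i=1}^N\alpha_i\mathbf{1}_{A_i}$ (with $\{A_i\}$ an $\mathcal{F}$-measurable partition of $\Omega$) it equals $\sum_{i=1}^N\alpha_i\mathfrak{p}(A_i)$, and in general $\int_{\Omega}f\,d\mathfrak{p}=\sup\{\int_{\Omega}s\,d\mathfrak{p}\mid s\text{ simple},\ s\le f\}$. *)

theory Defs
  imports "HOL-Analysis.Analysis" "HOL-Library.Function_Algebras"
begin

definition fun_scale :: "real \<Rightarrow> ('a \<Rightarrow> real) \<Rightarrow> 'a \<Rightarrow> real" where
  "fun_scale c f = (\<lambda>\<omega>. c * f \<omega>)"

interpretation real_fun: vector_space fun_scale
  by unfold_locales (auto simp: fun_scale_def algebra_simps)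

text \<open>A real function on the set \<open>\<Omega>\<close> is encoded by its extension by \<open>0\<close> to the whole type, so that
  equality of encodings is equality on \<open>\<Omega>\<close>, the vector space operations are those of
  \<^typ>\<open>'a \<Rightarrow> real\<close>, and \<open>1\<^sub>A\<close> for \<open>A \<subseteq> \<Omega>\<close> is \<^term>\<open>indicator A\<close>.\<close>

definition Linf :: "'a set \<Rightarrow> 'a set set \<Rightarrow> ('a \<Rightarrow> real) set" where
  "Linf \<Omega> F = {f \<in> borel_measurable (sigma \<Omega> F). bounded (f ` \<Omega>) \<and> (\<forall>\<omega>. \<omega> \<notin> \<Omega> \<longrightarrow> f \<omega> = 0)}"

text \<open>A prevision \<open>\<rho> : K \<rightarrow> \<real>\<close> is a total function of which only the values on \<open>K\<close> matter.
  The infimum is taken in the extended reals, so that nothing is coherent over an empty \<open>\<Omega>\<close>.\<close>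

definition coherent :: "'a set \<Rightarrow> ('a \<Rightarrow> real) set \<Rightarrow> (('a \<Rightarrow> real) \<Rightarrow> real) \<Rightarrow> bool" where
  "coherent \<Omega> K \<rho> \<longleftrightarrow>
    (\<forall>(n::nat) f \<beta>. (\<forall>i\<in>{1..n}. f i \<in> K) \<longrightarrow>
      (INF \<omega>\<in>\<Omega>. ereal (\<Sum>i=1..n. \<beta> i * (\<rho> (f i) - f i \<omega>))) \<le> 0)"

text \<open>The value at \<open>f = \<Sum>\<^sub>i \<alpha>\<^sub>i f\<^sub>i\<close>, with \<open>f\<^sub>i \<in> H\<close>, is \<open>\<Sum>\<^sub>i \<alpha>\<^sub>i \<pi>(f\<^sub>i)\<close>. It does not depend on the
  representation if \<open>\<pi>\<close> is coherent on \<open>H\<close>; see \<open>linear_extension_eq\<close> below.\<close>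

definition linear_extension ::
    "('a \<Rightarrow> real) set \<Rightarrow> (('a \<Rightarrow> real) \<Rightarrow> real) \<Rightarrow> ('a \<Rightarrow> real) \<Rightarrow> real" where
  "linear_extension H \<pi> f =
    (THE v. \<exists>t r. finite t \<and> t \<subseteq> H \<and> f = (\<Sum>h\<in>t. fun_scale (r h) h) \<and> v = (\<Sum>h\<in>t. r h * \<pi> h))"

text \<open>The function \<open>f + \<alpha> g \<mapsto> L f + \<alpha> c\<close> for \<open>f \<in> V\<close> and \<open>\<alpha> \<in> \<real>\<close>; it is well defined if \<open>V\<close> is a
  linear space and \<open>g \<notin> V\<close>; see \<open>price_extension_eq\<close> below.\<close>

definition price_extension ::
    "('a \<Rightarrow> real) set \<Rightarrow> (('a \<Rightarrow> real) \<Rightarrow> real) \<Rightarrow> ('a \<Rightarrow> real) \<Rightarrow> real \<Rightarrow> ('a \<Rightarrow> real) \<Rightarrow> real" where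
  "price_extension V L g c h =
    (THE v. \<exists>f\<in>V. \<exists>\<alpha>. h = f + fun_scale \<alpha> g \<and> v = L f + \<alpha> * c)"

definition lower_price ::
    "'a set \<Rightarrow> ('a \<Rightarrow> real) set \<Rightarrow> (('a \<Rightarrow> real) \<Rightarrow> real) \<Rightarrow> ('a \<Rightarrow> real) \<Rightarrow> ereal" where
  "lower_price \<Omega> V L g = (SUP f\<in>{f \<in> V. \<forall>\<omega>\<in>\<Omega>. f \<omega> \<le> g \<omega>}. ereal (L f))"

definition upper_price ::
    "'a set \<Rightarrow> ('a \<Rightarrow> real) set \<Rightarrow> (('a \<Rightarrow> real) \<Rightarrow> real) \<Rightarrow> ('a \<Rightarrow> real) \<Rightarrow> ereal" where
  "upper_price \<Omega> V L g = (INF f\<in>{f \<in> V. \<forall>\<omega>\<in>\<Omega>. f \<omega> \<ge> g \<omega>}. ereal (L f))"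

definition fa_prob :: "'a set \<Rightarrow> 'a set set \<Rightarrow> ('a set \<Rightarrow> real) set" where
  "fa_prob \<Omega> F = {p. (\<forall>A\<in>F. 0 \<le> p A) \<and> p \<Omega> = 1 \<and> additive F p}"

text \<open>The integral of a simple function is given by its coarsest representation, as for the
  library's \<^const>\<open>simple_integral\<close>; any other measurable partition yields the same value,
  see \<open>fa_simple_integral_partition\<close> below.\<close>

definition fa_simple_integral :: "'a set \<Rightarrow> ('a set \<Rightarrow> real) \<Rightarrow> ('a \<Rightarrow> real) \<Rightarrow> real" where
  "fa_simple_integral \<Omega> p s = (\<Sum>x\<in>s ` \<Omega>. x * p (s -` {x} \<inter> \<Omega>))"

definition fa_integral :: "'a set \<Rightarrow> 'a set set \<Rightarrow> ('a set \<Rightarrow> real) \<Rightarrow> ('a \<Rightarrow> real) \<Rightarrow> real" where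
  "fa_integral \<Omega> F p f =
    (SUP s\<in>{s. simple_function (sigma \<Omega> F) s \<and> (\<forall>\<omega>\<in>\<Omega>. s \<omega> \<le> f \<omega>)}. fa_simple_integral \<Omega> p s)"

definition pricing_measures ::
    "'a set \<Rightarrow> 'a set set \<Rightarrow> ('a \<Rightarrow> real) set \<Rightarrow> (('a \<Rightarrow> real) \<Rightarrow> real) \<Rightarrow> ('a set \<Rightarrow> real) set" where
  "pricing_measures \<Omega> F H \<pi> = {p \<in> fa_prob \<Omega> F. \<forall>h\<in>H. fa_integral \<Omega> F p h = \<pi> h}"


lemma sum_fun_scale_apply: "(\<Sum>h\<in>t. fun_scale (r h) h) \<omega> = (\<Sum>h\<in>t. r h * h \<omega>)"
  by (induction t rule: infinite_finite_induct) (auto simp: fun_scale_def)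

lemma coherent_sum_zero:
  assumes "coherent \<Omega> H \<pi>" "finite t" "t \<subseteq> H" "\<And>\<omega>. \<omega> \<in> \<Omega> \<Longrightarrow> (\<Sum>h\<in>t. r h * h \<omega>) = 0"
  shows "(\<Sum>h\<in>t. r h * \<pi> h) = 0"
proof -
  have le: "(\<Sum>h\<in>t. q h * \<pi> h) \<le> 0" if z: "\<And>\<omega>. \<omega> \<in> \<Omega> \<Longrightarrow> (\<Sum>h\<in>t. q h * h \<omega>) = 0" for q
  proof -
    obtain b where b: "bij_betw b {1..card t} t"
      using ex_bij_betw_nat_finite_1[OF assms(2)] by blast
    have "(\<Sum>i=1..card t. q (b i) * (\<pi> (b i) - b i \<omega>)) = (\<Sum>h\<in>t. q h * \<pi> h)" if "\<omega> \<in> \<Omega>" for \<omega>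
    proof -
      have "(\<Sum>i=1..card t. q (b i) * (\<pi> (b i) - b i \<omega>)) = (\<Sum>h\<in>t. q h * (\<pi> h - h \<omega>))"
        by (rule sum.reindex_bij_betw[OF b])
      then show ?thesis using z[OF that] by (simp add: algebra_simps sum_subtractf)
    qed
    moreover have "\<forall>i\<in>{1..card t}. b i \<in> H"
      using b assms(3) by (auto dest: bij_betwE)
    then have "(INF \<omega>\<in>\<Omega>. ereal (\<Sum>i=1..card t. q (b i) * (\<pi> (b i) - b i \<omega>))) \<le> 0"
      using assms(1) unfolding coherent_def
      by (elim allE[of _ "card t"] allE[of _ b] allE[of _ "\<lambda>i. q (b i)"]) blast
    ultimately have I: "(INF \<omega>\<in>\<Omega>. ereal (\<Sum>h\<in>t. q h * \<pi> h)) \<le> 0"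
      by (simp cong: INF_cong)
    show ?thesis
    proof (cases "\<Omega> = {}")
      case True
      then show ?thesis using I by (simp add: top_ereal_def)
    next
      case False
      then show ?thesis using I by simp
    qed
  qed
  have "(\<Sum>h\<in>t. - r h * \<pi> h) \<le> 0"
    by (rule le) (use assms(4) in \<open>simp add: sum_negf\<close>)
  with le[of r] assms(4) show ?thesis by (simp add: sum_negf)
qed

lemma linear_extension_eq:
  assumes "coherent \<Omega> H \<pi>" "finite t" "t \<subseteq> H"
  shows "linear_extension H \<pi> (\<Sum>h\<in>t. fun_scale (r h) h) = (\<Sum>h\<in>t. r h * \<pi> h)"
  unfolding linear_extension_def
proof (rule the_equality)
  fix v
  assume "\<exists>t' r'. finite t' \<and> t' \<subseteq> H \<and>
    (\<Sum>h\<in>t. fun_scale (r h) h) = (\<Sum>h\<in>t'. fun_scale (r' h) h) \<and> v = (\<Sum>h\<in>t'. r' h * \<pi> h)"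
  then obtain t' r' where t': "finite t'" "t' \<subseteq> H"
    and e: "(\<Sum>h\<in>t. fun_scale (r h) h) = (\<Sum>h\<in>t'. fun_scale (r' h) h)"
    and v: "v = (\<Sum>h\<in>t'. r' h * \<pi> h)" by blast
  define q where "q h = (if h \<in> t then r h else 0) - (if h \<in> t' then r' h else 0)" for h
  have split: "(\<Sum>h\<in>t \<union> t'. q h * k h) = (\<Sum>h\<in>t. r h * k h) - (\<Sum>h\<in>t'. r' h * k h)"
    for k :: "_ \<Rightarrow> real"
  proof -
    have "(\<Sum>h\<in>t \<union> t'. q h * k h) = (\<Sum>h\<in>t \<union> t'. if h \<in> t then r h * k h else 0)
        - (\<Sum>h\<in>t \<union> t'. if h \<in> t' then r' h * k h else 0)"
      unfolding sum_subtractf[symmetric] q_def by (rule sum.cong) (auto simp: algebra_simps)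
    then show ?thesis
      using assms(2) t'(1) by (simp add: sum.If_cases Int_absorb1)
  qed
  have "(\<Sum>h\<in>t \<union> t'. q h * h \<omega>) = 0" for \<omega>
    unfolding split[of "\<lambda>h. h \<omega>"] using fun_cong[OF e, of \<omega>] by (simp add: sum_fun_scale_apply)
  then have "(\<Sum>h\<in>t \<union> t'. q h * \<pi> h) = 0"
    using coherent_sum_zero[OF assms(1), of "t \<union> t'" q] assms t' by auto
  then show "v = (\<Sum>h\<in>t. r h * \<pi> h)" using split[of \<pi>] v by simp
qed (use assms in blast)

lemma price_extension_eq:
  assumes V: "real_fun.subspace V" and "g \<notin> V" "f \<in> V"
  shows "price_extension V L g c (f + fun_scale \<alpha> g) = L f + \<alpha> * c"
  unfolding price_extension_def
proof (rule the_equality)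
  fix v
  assume "\<exists>f'\<in>V. \<exists>\<alpha>'. f + fun_scale \<alpha> g = f' + fun_scale \<alpha>' g \<and> v = L f' + \<alpha>' * c"
  then obtain f' \<alpha>' where f': "f' \<in> V" and e: "f + fun_scale \<alpha> g = f' + fun_scale \<alpha>' g"
    and v: "v = L f' + \<alpha>' * c" by blast
  have "\<alpha>' = \<alpha>"
  proof (rule ccontr)
    assume ne: "\<alpha>' \<noteq> \<alpha>"
    have "f \<omega> - f' \<omega> = (\<alpha>' - \<alpha>) * g \<omega>" for \<omega>
      using fun_cong[OF e, of \<omega>] by (simp add: fun_scale_def algebra_simps)
    then have "g = fun_scale (1 / (\<alpha>' - \<alpha>)) (f - f')"
      using ne by (auto simp: fun_scale_def fun_eq_iff)
    with V f' assms(2,3) show False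
      by (metis real_fun.subspace_diff real_fun.subspace_scale)
  qed
  with e v show "v = L f + \<alpha> * c" by simp
qed (use assms in blast)

lemma fa_simple_integral_partition:
  assumes F: "sigma_algebra \<Omega> F" and p: "p \<in> fa_prob \<Omega> F"
    and I: "finite I" and A: "\<And>i. i \<in> I \<Longrightarrow> A i \<in> F" "disjoint_family_on A I" "(\<Union>i\<in>I. A i) = \<Omega>"
    and s: "\<And>i \<omega>. i \<in> I \<Longrightarrow> \<omega> \<in> A i \<Longrightarrow> s \<omega> = a i"
  shows "fa_simple_integral \<Omega> p s = (\<Sum>i\<in>I. a i * p (A i))"
proof -
  interpret sigma_algebra \<Omega> F by fact
  have add: "additive F p" using p by (simp add: fa_prob_def)
  have p0: "p {} = 0" using additiveD[OF add, of "{}" "{}"] by simp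
  have Un: "p (\<Union>i\<in>J. A i) = (\<Sum>i\<in>J. p (A i))" if "J \<subseteq> I" for J
    using finite_subset[OF that I] that
  proof (induction J rule: finite_induct)
    case (insert j J)
    have "A j \<inter> (\<Union>i\<in>J. A i) = {}"
      using A(2) insert by (fastforce simp: disjoint_family_on_def)
    moreover have "A j \<in> F" "(\<Union>i\<in>J. A i) \<in> F"
      using A(1) insert by auto
    ultimately show ?case
      using insert additiveD[OF add, of "A j" "\<Union>i\<in>J. A i"] by simp
  qed (simp add: p0)
  have img: "s ` \<Omega> = a ` {i \<in> I. A i \<noteq> {}}"
    using s A(3) by (force simp: image_iff)
  have lev: "s -` {x} \<inter> \<Omega> = (\<Union>i\<in>{i \<in> I. A i \<noteq> {} \<and> a i = x}. A i)" for x
    using s A(3) by fastforce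
  have "fa_simple_integral \<Omega> p s =
      (\<Sum>x\<in>a ` {i \<in> I. A i \<noteq> {}}. \<Sum>i\<in>{i \<in> {i \<in> I. A i \<noteq> {}}. a i = x}. a i * p (A i))"
    unfolding fa_simple_integral_def img lev
    by (rule sum.cong[OF refl], subst Un) (auto simp: sum_distrib_left conj_assoc)
  also have "\<dots> = (\<Sum>i\<in>{i \<in> I. A i \<noteq> {}}. a i * p (A i))"
    by (rule sum.image_gen[symmetric]) (use I in simp)
  also have "\<dots> = (\<Sum>i\<in>I. a i * p (A i))"
    by (rule sum.mono_neutral_left) (use I p0 in auto)
  finally show ?thesis .
qed

end

theory Submission
  imports Defs
begin

text \<open>On a linear space that contains the constants, coherence of a normalised linear functional is
  positivity. A linear extension by the value \<open>c\<close> at \<open>g\<close> is positive precisely when \<open>c\<close> lies between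
  the lower and the upper price: \<open>f + \<alpha> g \<ge> 0\<close> says that \<open>-f/\<alpha>\<close> lies below \<open>g\<close> if \<open>\<alpha> > 0\<close> and above \<open>g\<close>
  if \<open>\<alpha> < 0\<close>. By Zorn's lemma these one-step extensions accumulate to a positive functional on all
  bounded measurable functions. Uniform approximation by simple functions shows that such
  functionals are exactly the integrals with respect to finitely additive probabilities, so the
  price bounds are attained by pricing measures.\<close>

section \<open>Coherence and positive functionals\<close>

text \<open>Already the empty combination \<open>n = 0\<close> decides: over an empty \<Omega> its
  infimum is plus infinity in the extended reals, which is not at most 0.\<close>

lemma coherent_nonempty:
  assumes "coherent \<Omega> K \<rho>"
  shows "\<Omega> \<noteq> {}"
proof
  assume "\<Omega> = {}"
  with assms show False
    unfolding coherent_def by (auto simp: top_ereal_def dest: spec[of _ "0::nat"])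
qed

text \<open>The working form of coherence: bets are indexed by a finite set of functions instead of
  \<open>1..n\<close>, and a uniform lower bound \<open>a\<close> of the gain replaces the infimum
  in the extended reals.\<close>

lemma coherent_no_sure_gain:
  assumes "coherent \<Omega> K \<rho>" "finite t" "t \<subseteq> K"
    and a: "\<And>\<omega>. \<omega> \<in> \<Omega> \<Longrightarrow> a \<le> (\<Sum>h\<in>t. r h * (\<rho> h - h \<omega>))"
  shows "a \<le> 0"
proof -
  obtain b where b: "bij_betw b {1..card t} t"
    using ex_bij_betw_nat_finite_1[OF assms(2)] by blast
  have "\<forall>i\<in>{1..card t}. b i \<in> K"
    using b assms(3) by (auto dest: bij_betwE)
  then have "(INF \<omega>\<in>\<Omega>. ereal (\<Sum>i=1..card t. r (b i) * (\<rho> (b i) - b i \<omega>))) \<le> 0"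
    using assms(1) unfolding coherent_def
    by (elim allE[of _ "card t"] allE[of _ b] allE[of _ "\<lambda>i. r (b i)"]) blast
  moreover have "(\<Sum>i=1..card t. r (b i) * (\<rho> (b i) - b i \<omega>)) = (\<Sum>h\<in>t. r h * (\<rho> h - h \<omega>))" for \<omega>
    by (rule sum.reindex_bij_betw[OF b])
  moreover have "ereal a \<le> (INF \<omega>\<in>\<Omega>. ereal (\<Sum>h\<in>t. r h * (\<rho> h - h \<omega>)))"
    using a by (intro INF_greatest) auto
  ultimately have "ereal a \<le> 0"
    by (metis (no_types, lifting) INF_cong order_trans)
  then show ?thesis by simp
qed

section \<open>Normalised and positive linear functionals\<close>

lemma sum_fun_scale_family_apply:
  "(\<Sum>i\<in>I. fun_scale (c i) (f i)) \<omega> = (\<Sum>i\<in>I. c i * f i \<omega>)"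
  by (induction I rule: infinite_finite_induct) (auto simp: fun_scale_def)

text \<open>Positivity is kept separate because it is the property to be characterised: every price
  extension by a function outside \<open>V\<close> is normalised and linear, but only admissible
  prices make it positive.\<close>

locale normalized_functional =
  fixes \<Omega> :: "'a set" and V :: "('a \<Rightarrow> real) set" and E :: "('a \<Rightarrow> real) \<Rightarrow> real"
  assumes subspace: "real_fun.subspace V"
    and one_mem: "indicator \<Omega> \<in> V"
    and add: "f \<in> V \<Longrightarrow> h \<in> V \<Longrightarrow> E (f + h) = E f + E h"
    and scale: "f \<in> V \<Longrightarrow> E (fun_scale c f) = c * E f"
    and one: "E (indicator \<Omega>) = 1"
begin

lemma const_mem: "fun_scale c (indicator \<Omega>) \<in> V"
  using subspace one_mem by (rule real_fun.subspace_scale)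

lemma const: "E (fun_scale c (indicator \<Omega>)) = c"
  by (simp add: scale one_mem one)

lemma diff:
  assumes "f \<in> V" "h \<in> V"
  shows "E (f - h) = E f - E h"
  using add[of "f - h" h] assms real_fun.subspace_diff[OF subspace] by simp

text \<open>Stated for indexed families, so that repetitions among the \<open>f i\<close> are
  covered, as the definition of coherence requires.\<close>

lemma sum:
  assumes "\<And>i. i \<in> I \<Longrightarrow> f i \<in> V"
  shows "E (\<Sum>i\<in>I. fun_scale (c i) (f i)) = (\<Sum>i\<in>I. c i * E (f i))"
  using assms
proof (induction I rule: infinite_finite_induct)
  case (insert i I)
  have "(\<Sum>i\<in>I. fun_scale (c i) (f i)) \<in> V"
    using insert by (intro real_fun.subspace_sum real_fun.subspace_scale subspace) auto
  moreover have "(\<Sum>i\<in>insert i I. fun_scale (c i) (f i)) =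
      fun_scale (c i) (f i) + (\<Sum>i\<in>I. fun_scale (c i) (f i))"
    using insert.hyps by (rule sum.insert)
  ultimately have "E (\<Sum>i\<in>insert i I. fun_scale (c i) (f i)) =
      c i * E (f i) + (\<Sum>i\<in>I. c i * E (f i))"
    using insert by (simp only: add scale real_fun.subspace_scale[OF subspace] insertI1 insertI2)
  then show ?case
    unfolding sum.insert[OF insert.hyps, of "\<lambda>i. c i * E (f i)"] .
\<comment> \<open>Scaling the constant by 0 gives \<open>E 0 = 0\<close>, which settles both the
  empty and the infinite index set.\<close>
qed (use scale[OF one_mem, of 0] in simp_all)

end

locale positive_functional = normalized_functional +
  assumes nonneg: "f \<in> V \<Longrightarrow> (\<And>\<omega>. \<omega> \<in> \<Omega> \<Longrightarrow> 0 \<le> f \<omega>) \<Longrightarrow> 0 \<le> E f"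
begin

lemma mono:
  assumes "f \<in> V" "h \<in> V" "\<And>\<omega>. \<omega> \<in> \<Omega> \<Longrightarrow> f \<omega> \<le> h \<omega>"
  shows "E f \<le> E h"
  using nonneg[of "h - f"] diff[of h f] real_fun.subspace_diff[OF subspace] assms by simp

text \<open>Positive normalised functionals are nonexpansive for the supremum norm on \<Omega>:
  \<open>f\<close> lies below \<open>h\<close> plus the constant \<open>e\<close>, whose value is
  \<open>e\<close>, and conversely.\<close>

lemma abs_diff_le:
  assumes "f \<in> V" "h \<in> V" "\<And>\<omega>. \<omega> \<in> \<Omega> \<Longrightarrow> \<bar>f \<omega> - h \<omega>\<bar> \<le> e"
  shows "\<bar>E f - E h\<bar> \<le> e"
proof -
  let ?e = "fun_scale e (indicator \<Omega>)"
  have pm: "- e \<le> f \<omega> - h \<omega> \<and> f \<omega> - h \<omega> \<le> e" if "\<omega> \<in> \<Omega>" for \<omega>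
    using assms(3)[OF that] by linarith
  have "E f \<le> E (h + ?e)"
    using assms(1,2) pm
    by (intro mono real_fun.subspace_add subspace const_mem) (fastforce simp: fun_scale_def)+
  moreover have "E h \<le> E (f + ?e)"
    using assms(1,2) pm
    by (intro mono real_fun.subspace_add subspace const_mem) (fastforce simp: fun_scale_def)+
  ultimately show ?thesis
    using assms(1,2) by (simp add: add const_mem const abs_le_iff)
qed

end

text \<open>A bet with coefficient -1 on a nonnegative \<open>f\<close> gains at least
  \<open>- E f\<close>, so coherence forces \<open>0 \<le> E f\<close>. Conversely, linearity
  collapses any combination of bets into one bet \<open>E h - h\<close>, and a gain bounded below by
  some \<open>d > 0\<close> would put \<open>h\<close> below the constant \<open>E h - d\<close>,
  against monotonicity.\<close>

lemma (in normalized_functional) coherent_iff_positive: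
  assumes "\<Omega> \<noteq> {}"
  shows "coherent \<Omega> V E \<longleftrightarrow> positive_functional \<Omega> V E"
proof
  assume c: "coherent \<Omega> V E"
  show "positive_functional \<Omega> V E"
  proof unfold_locales
    fix f assume f: "f \<in> V" "\<And>\<omega>. \<omega> \<in> \<Omega> \<Longrightarrow> 0 \<le> f \<omega>"
    then have "- E f \<le> 0"
      by (intro coherent_no_sure_gain[OF c, of "{f}" _ "\<lambda>_. -1"]) auto
    then show "0 \<le> E f" by simp
  qed
next
  assume "positive_functional \<Omega> V E"
  then interpret positive_functional \<Omega> V E .
  show "coherent \<Omega> V E"
    unfolding coherent_def
  proof (intro allI impI)
    fix n :: nat and f \<beta>
    assume f: "\<forall>i\<in>{1..n}. f i \<in> V"
    define h where "h = (\<Sum>i=1..n. fun_scale (\<beta> i) (f i))"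
    have hV: "h \<in> V"
      unfolding h_def using f by (intro real_fun.subspace_sum real_fun.subspace_scale subspace) auto
    have Eh: "E h = (\<Sum>i=1..n. \<beta> i * E (f i))"
      unfolding h_def using f by (intro sum) auto
    have h\<omega>: "h \<omega> = (\<Sum>i=1..n. \<beta> i * f i \<omega>)" for \<omega>
      unfolding h_def by (rule sum_fun_scale_family_apply)
    have e: "(\<Sum>i=1..n. \<beta> i * (E (f i) - f i \<omega>)) = E h - h \<omega>" for \<omega>
      unfolding Eh h\<omega> by (simp add: right_diff_distrib sum_subtractf)
    show "(INF \<omega>\<in>\<Omega>. ereal (\<Sum>i=1..n. \<beta> i * (E (f i) - f i \<omega>))) \<le> 0"
      unfolding e
    proof (rule ccontr)
      assume "\<not> (INF \<omega>\<in>\<Omega>. ereal (E h - h \<omega>)) \<le> 0"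
      \<comment> \<open>A real number strictly between 0 and the infimum is chosen because
        \<open>V\<close> contains only real constants.\<close>
      then obtain d where d: "0 < ereal d" "ereal d < (INF \<omega>\<in>\<Omega>. ereal (E h - h \<omega>))"
        using ereal_dense2 by (metis not_le)
      have "h \<omega> \<le> fun_scale (E h - d) (indicator \<Omega>) \<omega>" if "\<omega> \<in> \<Omega>" for \<omega>
        using less_INF_D[OF d(2) that] that by (simp add: fun_scale_def)
      then have "E h \<le> E h - d"
        using mono[OF hV const_mem] const by metis
      with d(1) show False by simp
    qed
  qed
qed

section \<open>The linear extension and its price extensions as functionals\<close>

lemma span_common_support:
  assumes "f \<in> real_fun.span H" "k \<in> real_fun.span H"
  obtains t r q where "finite t" "t \<subseteq> H" "f = (\<Sum>h\<in>t. fun_scale (r h) h)"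
    "k = (\<Sum>h\<in>t. fun_scale (q h) h)"
proof -
  obtain t r where t: "finite t" "t \<subseteq> H" "f = (\<Sum>h\<in>t. fun_scale (r h) h)"
    using assms(1) unfolding real_fun.span_explicit by blast
  obtain u q where u: "finite u" "u \<subseteq> H" "k = (\<Sum>h\<in>u. fun_scale (q h) h)"
    using assms(2) unfolding real_fun.span_explicit by blast
  \<comment> \<open>Coefficients are padded with 0 on the union of the two supports; with a common
    support, sums can be taken coefficientwise.\<close>
  have "f = (\<Sum>h\<in>t \<union> u. fun_scale (if h \<in> t then r h else 0) h)"
    unfolding t(3) using t(1) u(1) by (intro sum.mono_neutral_cong_left) auto
  moreover have "k = (\<Sum>h\<in>t \<union> u. fun_scale (if h \<in> u then q h else 0) h)"
    unfolding u(3) using t(1) u(1) by (intro sum.mono_neutral_cong_left) auto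
  moreover have "finite (t \<union> u)" "t \<union> u \<subseteq> H" using t u by auto
  ultimately show ?thesis by (rule that[rotated 2])
qed

lemma linear_extension_base:
  assumes "coherent \<Omega> H \<pi>" "h \<in> H"
  shows "linear_extension H \<pi> h = \<pi> h"
  using linear_extension_eq[OF assms(1), of "{h}" "\<lambda>_. 1"] assms(2) by simp

text \<open>Linearity follows from independence of the representation. Positivity and normalisation
  come from coherence on \<open>H\<close> itself, applied to suitable bets.\<close>

lemma linear_extension_positive_functional:
  assumes c: "coherent \<Omega> H \<pi>" and one: "indicator \<Omega> \<in> H"
  shows "positive_functional \<Omega> (real_fun.span H) (linear_extension H \<pi>)"
proof
  show "real_fun.subspace (real_fun.span H)" by (rule real_fun.subspace_span)
  show "indicator \<Omega> \<in> real_fun.span H" using one by (rule real_fun.span_base)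
  note eq = linear_extension_eq[OF c]
  show "linear_extension H \<pi> (f + k) = linear_extension H \<pi> f + linear_extension H \<pi> k"
    if "f \<in> real_fun.span H" "k \<in> real_fun.span H" for f k
  proof -
    obtain t r q where t: "finite t" "t \<subseteq> H" "f = (\<Sum>h\<in>t. fun_scale (r h) h)"
      "k = (\<Sum>h\<in>t. fun_scale (q h) h)"
      by (rule span_common_support[OF \<open>f \<in> _\<close> \<open>k \<in> _\<close>])
    then have "f + k = (\<Sum>h\<in>t. fun_scale (r h + q h) h)"
      by (simp add: real_fun.scale_left_distrib sum.distrib)
    with t show ?thesis by (simp add: eq distrib_right sum.distrib)
  qed
  show "linear_extension H \<pi> (fun_scale c f) = c * linear_extension H \<pi> f"
    if f: "f \<in> real_fun.span H" for c f
  proof -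
    obtain t r where t: "finite t" "t \<subseteq> H" "f = (\<Sum>h\<in>t. fun_scale (r h) h)"
      using f unfolding real_fun.span_explicit by blast
    then have "fun_scale c f = (\<Sum>h\<in>t. fun_scale (c * r h) h)"
      by (simp add: real_fun.scale_sum_right)
    with t show ?thesis by (simp add: eq sum_distrib_left mult.assoc)
  qed
  show "0 \<le> linear_extension H \<pi> f"
    if f: "f \<in> real_fun.span H" and nn: "\<And>\<omega>. \<omega> \<in> \<Omega> \<Longrightarrow> 0 \<le> f \<omega>" for f
  proof -
    obtain t r where t: "finite t" "t \<subseteq> H" "f = (\<Sum>h\<in>t. fun_scale (r h) h)"
      using f unfolding real_fun.span_explicit by blast
    \<comment> \<open>The bets with coefficients \<open>- r h\<close> have total gain
      \<open>f - L f\<close>, where \<open>L f\<close> is the sum of the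
      \<open>r h * \<pi> h\<close>. As \<open>f\<close> is nonnegative, \<open>- L f\<close> is a
      lower bound of that gain.\<close>
    have "- (\<Sum>h\<in>t. r h * \<pi> h) \<le> 0"
    proof (rule coherent_no_sure_gain[OF c t(1,2), of _ "\<lambda>h. - r h"])
      fix \<omega> assume "\<omega> \<in> \<Omega>"
      then have "0 \<le> (\<Sum>h\<in>t. r h * h \<omega>)"
        using nn[of \<omega>] by (simp add: t(3) sum_fun_scale_apply)
      then show "- (\<Sum>h\<in>t. r h * \<pi> h) \<le> (\<Sum>h\<in>t. - r h * (\<pi> h - h \<omega>))"
        by (simp add: right_diff_distrib sum_subtractf sum_negf)
    qed
    then show ?thesis using t by (simp add: eq)
  qed
  \<comment> \<open>The bets 1 and -1 on the constant function have the same gain everywhere on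
    \<Omega>; neither gain may be positive.\<close>
  have "\<pi> (indicator \<Omega>) - 1 \<le> 0"
    by (rule coherent_no_sure_gain[OF c, of "{indicator \<Omega>}" _ "\<lambda>_. 1"]) (use one in auto)
  moreover have "1 - \<pi> (indicator \<Omega>) \<le> 0"
    by (rule coherent_no_sure_gain[OF c, of "{indicator \<Omega>}" _ "\<lambda>_. -1"]) (use one in auto)
  ultimately show "linear_extension H \<pi> (indicator \<Omega>) = 1"
    by (simp add: linear_extension_base[OF c one])
qed

text \<open>Since \<open>g \<notin> V\<close>, the decomposition \<open>f + \<alpha> g\<close> is
  unique, so the operations act on \<open>f\<close> and \<alpha> separately, whatever the price
  \<open>c\<close>.\<close>

lemma (in normalized_functional) price_extension_normalized_functional:
  assumes g: "g \<notin> V"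
  shows "normalized_functional \<Omega> (real_fun.span (insert g V)) (price_extension V E g c)"
proof
  note eq = price_extension_eq[OF subspace g]
  have split: "\<exists>f\<in>V. \<exists>\<alpha>. k = f + fun_scale \<alpha> g" if k: "k \<in> real_fun.span (insert g V)" for k
  proof -
    obtain \<alpha> where "k - fun_scale \<alpha> g \<in> V"
      using k iffD2[OF real_fun.span_eq_iff subspace] by (auto simp: real_fun.span_insert)
    then show ?thesis by (intro bexI[of _ "k - fun_scale \<alpha> g"] exI[of _ \<alpha>]) auto
  qed
  show "real_fun.subspace (real_fun.span (insert g V))" by (rule real_fun.subspace_span)
  show "indicator \<Omega> \<in> real_fun.span (insert g V)"
    using one_mem by (intro real_fun.span_base) auto
  show "price_extension V E g c (indicator \<Omega>) = 1"
    using eq[OF one_mem, where \<alpha>=0] one by simp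
  show "price_extension V E g c (fun_scale d k) = d * price_extension V E g c k"
    if k: "k \<in> real_fun.span (insert g V)" for d k
  proof -
    obtain f \<alpha> where f: "f \<in> V" "k = f + fun_scale \<alpha> g" using split[OF k] by blast
    have "fun_scale d k = fun_scale d f + fun_scale (d * \<alpha>) g"
      by (simp add: f(2) real_fun.scale_right_distrib)
    with f show ?thesis
      using real_fun.subspace_scale[OF subspace] by (simp add: eq scale distrib_left)
  qed
  show "price_extension V E g c (k + l) = price_extension V E g c k + price_extension V E g c l"
    if k: "k \<in> real_fun.span (insert g V)" and l: "l \<in> real_fun.span (insert g V)" for k l
  proof -
    obtain f \<alpha> where f: "f \<in> V" "k = f + fun_scale \<alpha> g" using split[OF k] by blast
    obtain f' \<alpha>' where f': "f' \<in> V" "l = f' + fun_scale \<alpha>' g" using split[OF l] by blast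
    have "k + l = (f + f') + fun_scale (\<alpha> + \<alpha>') g"
      by (simp add: f(2) f'(2) real_fun.scale_left_distrib)
    moreover have "f + f' \<in> V" using subspace f(1) f'(1) by (rule real_fun.subspace_add)
    ultimately have "price_extension V E g c (k + l) = E (f + f') + (\<alpha> + \<alpha>') * c"
      by (simp only: eq)
    with f f' show ?thesis by (simp add: eq add distrib_right)
  qed
qed

section \<open>Extension of positive functionals\<close>

context positive_functional
begin

text \<open>For necessity, monotonicity of the extension compares its value \<open>c\<close> at
  \<open>g\<close> with the values \<open>E f\<close> for \<open>f\<close> in \<open>V\<close> below
  or above \<open>g\<close>. For sufficiency, a nonnegative \<open>f + \<alpha> g\<close> is divided
  by \<alpha>.\<close>

lemma price_extension_positive_iff:
  assumes g: "g \<notin> V"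
  shows "positive_functional \<Omega> (real_fun.span (insert g V)) (price_extension V E g c)
    \<longleftrightarrow> lower_price \<Omega> V E g \<le> ereal c \<and> ereal c \<le> upper_price \<Omega> V E g"
proof -
  interpret P: normalized_functional \<Omega> "real_fun.span (insert g V)" "price_extension V E g c"
    by (rule price_extension_normalized_functional[OF g])
  note eq = price_extension_eq[OF subspace g]
  have VP: "f \<in> real_fun.span (insert g V)" if "f \<in> V" for f
    using that by (intro real_fun.span_base) auto
  have gP: "g \<in> real_fun.span (insert g V)" by (intro real_fun.span_base) auto
  \<comment> \<open>Here \<open>g\<close> is decomposed as \<open>0 + 1 g\<close>, and
    \<open>const\<close> at 0 supplies \<open>E 0 = 0\<close>.\<close>
  have Pg: "price_extension V E g c g = c"
    using eq[OF real_fun.subspace_0[OF subspace], where \<alpha>=1] const[of 0] by simp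
  have PV: "price_extension V E g c f = E f" if "f \<in> V" for f
    using eq[OF that, where \<alpha>=0] by simp
  show ?thesis
  proof safe
    assume "positive_functional \<Omega> (real_fun.span (insert g V)) (price_extension V E g c)"
    then interpret P: positive_functional \<Omega> "real_fun.span (insert g V)" "price_extension V E g c" .
    show "lower_price \<Omega> V E g \<le> ereal c"
      unfolding lower_price_def using P.mono[OF VP gP] by (intro SUP_least) (auto simp: Pg PV)
    show "ereal c \<le> upper_price \<Omega> V E g"
      unfolding upper_price_def using P.mono[OF gP VP] by (intro INF_greatest) (auto simp: Pg PV)
  next
    assume lo: "lower_price \<Omega> V E g \<le> ereal c" and up: "ereal c \<le> upper_price \<Omega> V E g"
    have lo': "E f \<le> c" if "f \<in> V" "\<And>\<omega>. \<omega> \<in> \<Omega> \<Longrightarrow> f \<omega> \<le> g \<omega>" for f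
      using lo that unfolding lower_price_def SUP_le_iff by auto
    have up': "c \<le> E f" if "f \<in> V" "\<And>\<omega>. \<omega> \<in> \<Omega> \<Longrightarrow> g \<omega> \<le> f \<omega>" for f
      using up that unfolding upper_price_def le_INF_iff by auto
    show "positive_functional \<Omega> (real_fun.span (insert g V)) (price_extension V E g c)"
    proof unfold_locales
      fix k assume k: "k \<in> real_fun.span (insert g V)" and nn: "\<And>\<omega>. \<omega> \<in> \<Omega> \<Longrightarrow> 0 \<le> k \<omega>"
      obtain \<alpha> where \<alpha>: "k - fun_scale \<alpha> g \<in> V"
        using k iffD2[OF real_fun.span_eq_iff subspace] by (auto simp: real_fun.span_insert)
      define f where "f = k - fun_scale \<alpha> g"
      have f: "f \<in> V" using \<alpha> by (simp add: f_def)
      have k': "k = f + fun_scale \<alpha> g" by (simp add: f_def)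
      have nn': "0 \<le> f \<omega> + \<alpha> * g \<omega>" if "\<omega> \<in> \<Omega>" for \<omega>
        using nn[OF that] by (simp add: k' fun_scale_def)
      \<comment> \<open>The element of \<open>V\<close> to compare with \<open>g\<close>: it lies
        below \<open>g\<close> if \<open>\<alpha> > 0\<close> and above \<open>g\<close> if
        \<open>\<alpha> < 0\<close>. The case \<open>\<alpha> = 0\<close> is plain positivity of
        \<open>E\<close>.\<close>
      let ?h = "fun_scale (- 1 / \<alpha>) f"
      have h: "?h \<in> V" "E ?h = - 1 / \<alpha> * E f"
        using f by (rule real_fun.subspace_scale[OF subspace], rule scale)
      consider "\<alpha> = 0" | "\<alpha> > 0" | "\<alpha> < 0" by linarith
      then have "0 \<le> E f + \<alpha> * c"
      proof cases
        case 1
        then show ?thesis using nonneg[OF f] nn' by simp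
      next
        case 2
        have "- 1 / \<alpha> * E f \<le> c"
          unfolding h(2)[symmetric]
        proof (intro lo' h)
          show "?h \<omega> \<le> g \<omega>" if "\<omega> \<in> \<Omega>" for \<omega>
            using nn'[OF that] 2 by (simp add: fun_scale_def field_simps)
        qed
        with 2 show ?thesis by (simp add: field_simps)
      next
        case 3
        have "c \<le> - 1 / \<alpha> * E f"
          unfolding h(2)[symmetric]
        proof (intro up' h)
          show "g \<omega> \<le> ?h \<omega>" if "\<omega> \<in> \<Omega>" for \<omega>
            using nn'[OF that] 3 by (simp add: fun_scale_def field_simps)
        qed
        with 3 show ?thesis by (simp add: field_simps)
      qed
      then show "0 \<le> price_extension V E g c k" by (simp add: k' eq f)
    qed
  qed
qed

text \<open>If \<open>K\<close> bounds the absolute value of \<open>g\<close>, the constants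
  \<open>- K\<close> and \<open>K\<close> are admissible in the supremum and the infimum;
  monotonicity of \<open>E\<close> orders the two prices. Hence an admissible real price always
  exists.\<close>

lemma prices_finite:
  assumes "bounded (g ` \<Omega>)"
  obtains l u where "lower_price \<Omega> V E g = ereal l" "upper_price \<Omega> V E g = ereal u" "l \<le> u"
proof -
  obtain K where K: "\<And>\<omega>. \<omega> \<in> \<Omega> \<Longrightarrow> \<bar>g \<omega>\<bar> \<le> K"
    using assms by (auto simp: bounded_iff)
  have "ereal (E (fun_scale (- K) (indicator \<Omega>))) \<le> lower_price \<Omega> V E g"
    unfolding lower_price_def
  proof (intro SUP_upper CollectI conjI ballI const_mem)
    show "fun_scale (- K) (indicator \<Omega>) \<omega> \<le> g \<omega>" if "\<omega> \<in> \<Omega>" for \<omega>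
      using K[OF that] that by (simp add: fun_scale_def)
  qed
  then have l: "ereal (- K) \<le> lower_price \<Omega> V E g" by (simp only: const)
  have "upper_price \<Omega> V E g \<le> ereal (E (fun_scale K (indicator \<Omega>)))"
    unfolding upper_price_def
  proof (intro INF_lower CollectI conjI ballI const_mem)
    show "g \<omega> \<le> fun_scale K (indicator \<Omega>) \<omega>" if "\<omega> \<in> \<Omega>" for \<omega>
      using K[OF that] that by (simp add: fun_scale_def)
  qed
  then have u: "upper_price \<Omega> V E g \<le> ereal K" by (simp only: const)
  have lu: "lower_price \<Omega> V E g \<le> upper_price \<Omega> V E g"
    unfolding lower_price_def upper_price_def
    by (intro SUP_least INF_greatest) (auto intro!: mono intro: order_trans)
  from l u lu show ?thesis
    by (cases "lower_price \<Omega> V E g"; cases "upper_price \<Omega> V E g") (auto intro: that)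
qed

end

section \<open>Graphs of positive functionals and Zorn's lemma\<close>

text \<open>Functionals are compared through their graphs. A linear subspace of pairs that contains no
  \<open>(f, v)\<close> with \<open>f \<ge> 0 > v\<close> is automatically single-valued.\<close>

definition positive_graph :: "'a set \<Rightarrow> ('a \<Rightarrow> real) set \<Rightarrow> (('a \<Rightarrow> real) \<times> real) set \<Rightarrow> bool" where
  "positive_graph \<Omega> W G \<longleftrightarrow> fst ` G \<subseteq> W \<and> (indicator \<Omega>, 1) \<in> G
    \<and> (\<forall>x\<in>G. \<forall>y\<in>G. (fst x + fst y, snd x + snd y) \<in> G)
    \<and> (\<forall>x\<in>G. \<forall>c. (fun_scale c (fst x), c * snd x) \<in> G)
    \<and> (\<forall>x\<in>G. (\<forall>\<omega>\<in>\<Omega>. 0 \<le> fst x \<omega>) \<longrightarrow> 0 \<le> snd x)"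

lemma (in positive_functional) positive_graph:
  assumes "V \<subseteq> W"
  shows "positive_graph \<Omega> W ((\<lambda>f. (f, E f)) ` V)"
  using assms unfolding positive_graph_def
  by (auto simp: image_iff one_mem one add scale nonneg
      real_fun.subspace_add[OF subspace] real_fun.subspace_scale[OF subspace])

lemma positive_graph_functional:
  assumes "positive_graph \<Omega> W G"
  obtains V E where "positive_functional \<Omega> V E" "G = (\<lambda>f. (f, E f)) ` V" "V \<subseteq> W"
proof -
  have W: "fst ` G \<subseteq> W" and one: "(indicator \<Omega>, 1) \<in> G"
    and add': "\<forall>x\<in>G. \<forall>y\<in>G. (fst x + fst y, snd x + snd y) \<in> G"
    and scale': "\<forall>x\<in>G. \<forall>c. (fun_scale c (fst x), c * snd x) \<in> G"
    and nn': "\<forall>x\<in>G. (\<forall>\<omega>\<in>\<Omega>. 0 \<le> fst x \<omega>) \<longrightarrow> 0 \<le> snd x"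
    using assms unfolding positive_graph_def by blast+
  have add: "(f + h, v + w) \<in> G" if "(f, v) \<in> G" "(h, w) \<in> G" for f v h w
    using bspec[OF bspec[OF add' that(1)] that(2)] by simp
  have scale: "(fun_scale c f, c * v) \<in> G" if "(f, v) \<in> G" for f v c
    using bspec[OF scale' that] by simp
  have nn: "0 \<le> v" if "(f, v) \<in> G" "\<And>\<omega>. \<omega> \<in> \<Omega> \<Longrightarrow> 0 \<le> f \<omega>" for f v
    using bspec[OF nn' that(1)] that(2) by simp
  have le: "v \<le> w" if "(f, v) \<in> G" "(f, w) \<in> G" for f v w
  proof -
    \<comment> \<open>This pair is \<open>(0, w - v)\<close>, and its first component is
      nonnegative; exchanging \<open>v\<close> and \<open>w\<close> then gives uniqueness of the
      value.\<close>
    have "(f + fun_scale (-1) f, w + (-1) * v) \<in> G" using that by (intro add scale)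
    from nn[OF this] show ?thesis by (simp add: fun_scale_def)
  qed
  define E where "E f = (THE v. (f, v) \<in> G)" for f
  have E: "E f = v" if "(f, v) \<in> G" for f v
    unfolding E_def using that le by (intro the_equality) (auto intro: antisym)
  have mem: "(f, E f) \<in> G" if "f \<in> fst ` G" for f
    using that E by force
  have GE: "G = (\<lambda>f. (f, E f)) ` fst ` G"
    using E by (force simp: image_iff)
  have "positive_functional \<Omega> (fst ` G) E"
  proof
    have "(0, 0) \<in> G" using scale[OF one, of 0] by simp
    then show "real_fun.subspace (fst ` G)"
      unfolding real_fun.subspace_def
      by (auto intro!: image_eqI[of _ fst, OF fst_conv[symmetric]] add scale)
    show "indicator \<Omega> \<in> fst ` G" using one by force
    show "E (indicator \<Omega>) = 1" using one by (rule E)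
    show "E (f + h) = E f + E h" if "f \<in> fst ` G" "h \<in> fst ` G" for f h
      using mem[OF that(1)] mem[OF that(2)] by (intro E add)
    show "E (fun_scale c f) = c * E f" if "f \<in> fst ` G" for c f
      using mem[OF that] by (intro E scale)
    show "0 \<le> E f" if "f \<in> fst ` G" "\<And>\<omega>. \<omega> \<in> \<Omega> \<Longrightarrow> 0 \<le> f \<omega>" for f
      using mem[OF that(1)] that(2) by (rule nn)
  qed
  then show ?thesis using GE W by (rule that)
qed

text \<open>A Hahn-Banach argument: a maximal positive graph within \<open>W\<close> has all of
  \<open>W\<close> as its domain, because a bounded \<open>g\<close> outside the domain always has
  an admissible price and the graph could be enlarged.\<close>

lemma (in positive_functional) extend_to_bounded:
  assumes VW: "V \<subseteq> W" and W: "real_fun.subspace W" and bdd: "\<And>f. f \<in> W \<Longrightarrow> bounded (f ` \<Omega>)"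
  obtains E' where "positive_functional \<Omega> W E'" "\<And>f. f \<in> V \<Longrightarrow> E' f = E f"
proof -
  define G0 where "G0 = (\<lambda>f. (f, E f)) ` V"
  define A where "A = {G. positive_graph \<Omega> W G \<and> G0 \<subseteq> G}"
  have "\<exists>M\<in>A. \<forall>X\<in>A. M \<subseteq> X \<longrightarrow> X = M"
  proof (rule subset_Zorn_nonempty)
    show "A \<noteq> {}" using positive_graph[OF VW] by (auto simp: A_def G0_def)
    fix C assume C: "C \<noteq> {}" "subset.chain A C"
    have CA: "positive_graph \<Omega> W X" "G0 \<subseteq> X" if "X \<in> C" for X
      using C(2) that unfolding A_def subset.chain_def by auto
    \<comment> \<open>In a chain any two pairs lie in a common member, so closure under addition
      passes to the union.\<close>
    have pair: "\<exists>X\<in>C. x \<in> X \<and> y \<in> X" if "x \<in> \<Union>C" "y \<in> \<Union>C" for x y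
    proof -
      obtain X Y where "X \<in> C" "x \<in> X" "Y \<in> C" "y \<in> Y" using \<open>x \<in> \<Union>C\<close> \<open>y \<in> \<Union>C\<close> by blast
      moreover have "X \<subseteq> Y \<or> Y \<subseteq> X"
        using C(2) \<open>X \<in> C\<close> \<open>Y \<in> C\<close> unfolding subset.chain_def by auto
      ultimately show ?thesis by blast
    qed
    have "positive_graph \<Omega> W (\<Union>C)"
      unfolding positive_graph_def
    proof (intro conjI ballI allI impI)
      show "fst ` \<Union>C \<subseteq> W" using CA(1) unfolding positive_graph_def by blast
      show "(indicator \<Omega>, 1) \<in> \<Union>C" using CA(1) C(1) unfolding positive_graph_def by blast
      show "(fst x + fst y, snd x + snd y) \<in> \<Union>C" if "x \<in> \<Union>C" "y \<in> \<Union>C" for x y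
      proof -
        obtain X where X: "X \<in> C" "x \<in> X" "y \<in> X" using pair[OF \<open>x \<in> _\<close> \<open>y \<in> _\<close>] by blast
        then have "(fst x + fst y, snd x + snd y) \<in> X"
          using CA(1)[OF X(1)] by (simp add: positive_graph_def)
        with X(1) show ?thesis by blast
      qed
      show "(fun_scale c (fst x), c * snd x) \<in> \<Union>C" if "x \<in> \<Union>C" for x c
      proof -
        obtain X where X: "X \<in> C" "x \<in> X" using \<open>x \<in> _\<close> by blast
        then have "(fun_scale c (fst x), c * snd x) \<in> X"
          using CA(1)[OF X(1)] by (simp add: positive_graph_def)
        with X(1) show ?thesis by blast
      qed
      show "0 \<le> snd x" if "x \<in> \<Union>C" "\<forall>\<omega>\<in>\<Omega>. 0 \<le> fst x \<omega>" for x
        using that CA(1) unfolding positive_graph_def by auto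
    qed
    then show "\<Union>C \<in> A" using CA(2) C(1) by (auto simp: A_def)
  qed
  then obtain M where M: "M \<in> A" and max: "\<And>X. X \<in> A \<Longrightarrow> M \<subseteq> X \<Longrightarrow> X = M" by blast
  have "positive_graph \<Omega> W M" using M by (simp add: A_def)
  then obtain U E' where U: "positive_functional \<Omega> U E'" and MU: "M = (\<lambda>f. (f, E' f)) ` U"
    and UW: "U \<subseteq> W"
    by (rule positive_graph_functional)
  interpret U: positive_functional \<Omega> U E' by (rule U)
  have "W \<subseteq> U"
  proof
    fix g assume gW: "g \<in> W"
    show "g \<in> U"
    proof (rule ccontr)
      assume gU: "g \<notin> U"
      obtain l u where lu: "lower_price \<Omega> U E' g = ereal l" "upper_price \<Omega> U E' g = ereal u" "l \<le> u"
        using U.prices_finite[OF bdd[OF gW]] by metis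
      \<comment> \<open>The lower price is merely a definite choice; any real number from
        \<open>l\<close> to \<open>u\<close> would give a positive extension.\<close>
      define P where "P = price_extension U E' g l"
      let ?S = "real_fun.span (insert g U)"
      interpret P: positive_functional \<Omega> ?S P
        unfolding P_def using U.price_extension_positive_iff[OF gU] lu by simp
      define X where "X = (\<lambda>f. (f, P f)) ` ?S"
      have "?S \<subseteq> W" using gW UW W by (intro real_fun.span_minimal) auto
      then have "positive_graph \<Omega> W X" unfolding X_def by (rule P.positive_graph)
      moreover have "P f = E' f" if "f \<in> U" for f
        using price_extension_eq[OF U.subspace gU that, of E' l 0] by (simp add: P_def)
      then have "M \<subseteq> X"
        unfolding MU X_def using real_fun.span_superset[of "insert g U"] by force
      \<comment> \<open>Maximality identifies the enlarged graph with \<open>M\<close>, although its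
        domain contains \<open>g\<close>.\<close>
      ultimately have "X = M" using M by (intro max) (auto simp: A_def)
      moreover have "g \<in> fst ` X"
        using real_fun.span_base[of g "insert g U"] by (force simp: X_def)
      ultimately show False using gU by (auto simp: MU)
    qed
  qed
  then have "U = W" using UW by blast
  moreover have "E' f = E f" if "f \<in> V" for f
    using M that unfolding A_def G0_def MU by auto
  ultimately show ?thesis using U that by blast
qed

section \<open>Integration with respect to finitely additive probabilities\<close>

lemma subspace_Linf: "real_fun.subspace (Linf \<Omega> F)"
  unfolding real_fun.subspace_def
proof (intro conjI ballI allI)
  show "0 \<in> Linf \<Omega> F" by (auto simp: Linf_def zero_fun_def bounded_iff)
  show "f + h \<in> Linf \<Omega> F" if "f \<in> Linf \<Omega> F" "h \<in> Linf \<Omega> F" for f h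
    using that bounded_plus_comp[of f \<Omega> h] by (auto simp: Linf_def plus_fun_def)
  show "fun_scale c f \<in> Linf \<Omega> F" if "f \<in> Linf \<Omega> F" for f c
    using that bounded_scaleR_comp[of f \<Omega> c] by (auto simp: Linf_def fun_scale_def)
qed

lemma simple_function_in_Linf:
  assumes "simple_function (sigma \<Omega> F) s" "F \<subseteq> Pow \<Omega>" "\<And>\<omega>. \<omega> \<notin> \<Omega> \<Longrightarrow> s \<omega> = 0"
  shows "s \<in> Linf \<Omega> F"
  using assms borel_measurable_simple_function[OF assms(1)]
  by (auto simp: Linf_def simple_function_def intro: finite_imp_bounded)

lemma indicator_in_Linf:
  assumes "sigma_algebra \<Omega> F" "A \<in> F"
  shows "indicator A \<in> Linf \<Omega> F"
proof -
  interpret sigma_algebra \<Omega> F by fact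
  have "A \<subseteq> \<Omega>" using assms(2) sets_into_space by auto
  moreover have "A \<in> sets (sigma \<Omega> F)" using assms(2) by auto
  then have "simple_function (sigma \<Omega> F) (indicator A :: _ \<Rightarrow> real)"
    by (rule simple_function_indicator)
  ultimately show ?thesis
    using space_closed by (intro simple_function_in_Linf) (auto simp: indicator_def)
qed

text \<open>Values are rounded down to multiples of \<open>e\<close>; boundedness of
  \<open>f\<close> leaves only finitely many of them.\<close>

lemma Linf_simple_approx:
  assumes F: "F \<subseteq> Pow \<Omega>" and f: "f \<in> Linf \<Omega> F" and e: "e > 0"
  obtains s where "simple_function (sigma \<Omega> F) s" "s \<in> Linf \<Omega> F"
    "\<And>\<omega>. \<omega> \<in> \<Omega> \<Longrightarrow> \<bar>f \<omega> - s \<omega>\<bar> \<le> e"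
proof -
  define s where "s \<omega> = e * of_int \<lfloor>f \<omega> / e\<rfloor>" for \<omega>
  obtain K where K: "\<And>\<omega>. \<omega> \<in> \<Omega> \<Longrightarrow> \<bar>f \<omega>\<bar> \<le> K"
    using f by (auto simp: bounded_iff Linf_def)
  have "s ` \<Omega> \<subseteq> (\<lambda>i. e * of_int i) ` {\<lfloor>- K / e\<rfloor>..\<lfloor>K / e\<rfloor>}"
  proof
    fix x assume "x \<in> s ` \<Omega>"
    then obtain \<omega> where \<omega>: "\<omega> \<in> \<Omega>" "x = s \<omega>" by blast
    have "- K \<le> f \<omega>" "f \<omega> \<le> K" using K[OF \<omega>(1)] by auto
    then have "- K / e \<le> f \<omega> / e" "f \<omega> / e \<le> K / e"
      using e by (simp_all only: divide_right_mono less_imp_le)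
    then show "x \<in> (\<lambda>i. e * of_int i) ` {\<lfloor>- K / e\<rfloor>..\<lfloor>K / e\<rfloor>}"
      using \<omega>(2) by (auto simp: s_def intro!: imageI floor_mono)
  qed
  then have fin: "finite (s ` \<Omega>)" by (rule finite_subset) auto
  have [measurable]: "f \<in> borel_measurable (sigma \<Omega> F)" using f by (simp add: Linf_def)
  have "s \<in> borel_measurable (sigma \<Omega> F)" unfolding s_def by measurable
  with fin F have s: "simple_function (sigma \<Omega> F) s"
    by (simp add: simple_function_borel_measurable)
  \<comment> \<open>Off \<Omega> the function \<open>f\<close> is 0, and 0 is rounded to 0, so
    \<open>s\<close> respects the encoding.\<close>
  moreover have "s \<in> Linf \<Omega> F"
    using f by (intro simple_function_in_Linf[OF s F]) (simp add: s_def Linf_def)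
  moreover have "\<bar>f \<omega> - s \<omega>\<bar> \<le> e" for \<omega>
  proof -
    have "e * \<bar>f \<omega> / e - of_int \<lfloor>f \<omega> / e\<rfloor>\<bar> \<le> e * 1"
      using e by (intro mult_left_mono) linarith+
    moreover have "f \<omega> - s \<omega> = e * (f \<omega> / e - of_int \<lfloor>f \<omega> / e\<rfloor>)"
      using e by (simp add: s_def right_diff_distrib)
    ultimately show ?thesis using e by (simp add: abs_mult)
  qed
  ultimately show ?thesis using that by blast
qed

text \<open>The factor \<open>C\<close> lets approximation errors be collected without rescaling
  \<open>e\<close> beforehand.\<close>

lemma eq_if_abs_diff_le_multiple:
  assumes "\<And>e. e > 0 \<Longrightarrow> \<bar>x - y\<bar> \<le> C * e"
  shows "x = (y::real)"
proof (rule ccontr)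
  assume "x \<noteq> y"
  then have d: "\<bar>x - y\<bar> > 0" by simp
  \<comment> \<open>This choice of \<open>e\<close> brings the bound down to half of the distance;
    the summand 1 keeps the denominator positive.\<close>
  have "\<bar>x - y\<bar> \<le> C * (\<bar>x - y\<bar> / (2 * (\<bar>C\<bar> + 1)))"
    using d by (intro assms) simp
  also have "\<dots> \<le> (\<bar>C\<bar> + 1) * (\<bar>x - y\<bar> / (2 * (\<bar>C\<bar> + 1)))"
    by (intro mult_right_mono) auto
  also have "\<dots> = \<bar>x - y\<bar> / 2"
    using abs_ge_zero[of C] by (simp add: field_simps)
  finally show False using d by simp
qed

section \<open>The integral as a positive functional\<close>

locale fa_prob_space = sigma_algebra \<Omega> F for \<Omega> :: "'a set" and F +
  fixes p :: "'a set \<Rightarrow> real"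
  assumes p: "p \<in> fa_prob \<Omega> F"
begin

abbreviation simple :: "('a \<Rightarrow> real) \<Rightarrow> bool" where
  "simple s \<equiv> simple_function (sigma \<Omega> F) s"

lemma p_nonneg: "A \<in> F \<Longrightarrow> 0 \<le> p A"
  using p by (simp add: fa_prob_def)

lemma simple_iff: "simple s \<longleftrightarrow> finite (s ` \<Omega>) \<and> (\<forall>x\<in>s ` \<Omega>. s -` {x} \<inter> \<Omega> \<in> F)"
  by (simp add: simple_function_def)

text \<open>The common refinement of the level sets of \<open>s\<close> and \<open>t\<close> serves
  every function of the pair. Taking projections and \<open>a * x + y\<close> for \<open>k\<close>
  reduces linearity and monotonicity to comparing sums term by term.\<close>

lemma simple_pair_integral:
  assumes "simple s" "simple t"
  shows "fa_simple_integral \<Omega> p (\<lambda>\<omega>. k (s \<omega>) (t \<omega>)) =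
    (\<Sum>(x, y)\<in>s ` \<Omega> \<times> t ` \<Omega>. k x y * p (s -` {x} \<inter> \<Omega> \<inter> (t -` {y} \<inter> \<Omega>)))"
proof -
  have "fa_simple_integral \<Omega> p (\<lambda>\<omega>. k (s \<omega>) (t \<omega>)) =
    (\<Sum>i\<in>s ` \<Omega> \<times> t ` \<Omega>. k (fst i) (snd i) * p (s -` {fst i} \<inter> \<Omega> \<inter> (t -` {snd i} \<inter> \<Omega>)))"
    using assms
    by (intro fa_simple_integral_partition[OF sigma_algebra_axioms p])
       (auto simp: simple_iff disjoint_family_on_def)
  then show ?thesis by (simp add: case_prod_beta)
qed

lemma simple_integral_linear:
  assumes "simple s" "simple t"
  shows "fa_simple_integral \<Omega> p (\<lambda>\<omega>. a * s \<omega> + t \<omega>)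
    = a * fa_simple_integral \<Omega> p s + fa_simple_integral \<Omega> p t"
  using simple_pair_integral[OF assms, of "\<lambda>x y. x"] simple_pair_integral[OF assms, of "\<lambda>x y. y"]
    simple_pair_integral[OF assms, of "\<lambda>x y. a * x + y"]
  by (simp add: case_prod_beta sum_distrib_left sum.distrib[symmetric] algebra_simps)

lemma simple_integral_mono:
  assumes "simple s" "simple t" "\<And>\<omega>. \<omega> \<in> \<Omega> \<Longrightarrow> s \<omega> \<le> t \<omega>"
  shows "fa_simple_integral \<Omega> p s \<le> fa_simple_integral \<Omega> p t"
  unfolding simple_pair_integral[OF assms(1,2), of "\<lambda>x y. x"]
    simple_pair_integral[OF assms(1,2), of "\<lambda>x y. y"]
proof (rule sum_mono, clarify)
  fix \<omega> \<omega>' assume \<omega>: "\<omega> \<in> \<Omega>" "\<omega>' \<in> \<Omega>"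
  let ?A = "s -` {s \<omega>} \<inter> \<Omega> \<inter> (t -` {t \<omega>'} \<inter> \<Omega>)"
  have A: "?A \<in> F" using assms(1,2) \<omega> by (auto simp: simple_iff)
  \<comment> \<open>The values \<open>s \<omega>\<close> and \<open>t \<omega>'\<close> come from
    possibly different points; they are comparable if the cell is nonempty, and an empty cell has
    weight 0.\<close>
  show "s \<omega> * p ?A \<le> t \<omega>' * p ?A"
  proof (cases "?A = {}")
    case True
    have "p {} = 0" using p additiveD[of F p "{}" "{}"] by (simp add: fa_prob_def)
    then show ?thesis unfolding True by simp
  next
    case False
    then have "s \<omega> \<le> t \<omega>'" using assms(3) by force
    then show ?thesis using p_nonneg[OF A] by (rule mult_right_mono)
  qed
qed

lemma simple_integral_const: "fa_simple_integral \<Omega> p (\<lambda>_. c) = c"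
proof -
  have "fa_simple_integral \<Omega> p (\<lambda>_. c) = (\<Sum>i\<in>{()}. c * p \<Omega>)"
    by (rule fa_simple_integral_partition[OF sigma_algebra_axioms p])
       (auto simp: disjoint_family_on_def)
  then show ?thesis using p by (simp add: fa_prob_def)
qed

lemma simple_integral_shift:
  assumes "simple s"
  shows "simple (\<lambda>\<omega>. s \<omega> + c)"
    and "fa_simple_integral \<Omega> p (\<lambda>\<omega>. s \<omega> + c) = fa_simple_integral \<Omega> p s + c"
  using assms simple_integral_linear[OF assms simple_function_const, of 1 c]
  by (auto simp: simple_integral_const intro: simple_function_compose1)

text \<open>The simple function \<open>s - e\<close> lies below \<open>f\<close>, and every simple
  function below \<open>f\<close> lies below \<open>s + e\<close>; the supremum is thus caught
  between the two integrals.\<close>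

lemma fa_integral_approx:
  assumes s: "simple s" and close: "\<And>\<omega>. \<omega> \<in> \<Omega> \<Longrightarrow> \<bar>f \<omega> - s \<omega>\<bar> \<le> e"
  shows "\<bar>fa_integral \<Omega> F p f - fa_simple_integral \<Omega> p s\<bar> \<le> e"
proof -
  let ?S = "{t. simple t \<and> (\<forall>\<omega>\<in>\<Omega>. t \<omega> \<le> f \<omega>)}"
  have pm: "s \<omega> + - e \<le> f \<omega> \<and> f \<omega> \<le> s \<omega> + e" if "\<omega> \<in> \<Omega>" for \<omega>
    using close[OF that] by linarith
  have up: "fa_simple_integral \<Omega> p t \<le> fa_simple_integral \<Omega> p s + e" if "t \<in> ?S" for t
  proof -
    have "fa_simple_integral \<Omega> p t \<le> fa_simple_integral \<Omega> p (\<lambda>\<omega>. s \<omega> + e)"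
      using that pm by (intro simple_integral_mono simple_integral_shift s) (auto intro: order_trans)
    then show ?thesis by (simp add: simple_integral_shift s)
  qed
  have mem: "(\<lambda>\<omega>. s \<omega> + - e) \<in> ?S" using pm simple_integral_shift(1)[OF s, of "- e"] by auto
  have "fa_integral \<Omega> F p f \<le> fa_simple_integral \<Omega> p s + e"
    unfolding fa_integral_def using mem up by (intro cSUP_least) blast+
  moreover have "fa_simple_integral \<Omega> p (\<lambda>\<omega>. s \<omega> + - e) \<le> fa_integral \<Omega> F p f"
    unfolding fa_integral_def by (rule cSUP_upper[OF mem]) (use up in \<open>auto intro!: bdd_aboveI2\<close>)
  then have "fa_simple_integral \<Omega> p s - e \<le> fa_integral \<Omega> F p f"
    using simple_integral_shift(2)[OF s, of "- e"] by simp
  ultimately show ?thesis by linarith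
qed

text \<open>The defining supremum does not treat negative \<open>a\<close> directly. Uniform
  approximation transfers linearity from simple functions, with the error
  \<open>\<bar>a\<bar> * e + e\<close> incurred twice.\<close>

lemma fa_integral_linear:
  assumes f: "f \<in> Linf \<Omega> F" and h: "h \<in> Linf \<Omega> F"
  shows "fa_integral \<Omega> F p (fun_scale a f + h) = a * fa_integral \<Omega> F p f + fa_integral \<Omega> F p h"
proof (rule eq_if_abs_diff_le_multiple)
  fix e :: real assume e: "e > 0"
  obtain s where s: "simple s" "\<And>\<omega>. \<omega> \<in> \<Omega> \<Longrightarrow> \<bar>f \<omega> - s \<omega>\<bar> \<le> e"
    using Linf_simple_approx[OF space_closed f e] by blast
  obtain t where t: "simple t" "\<And>\<omega>. \<omega> \<in> \<Omega> \<Longrightarrow> \<bar>h \<omega> - t \<omega>\<bar> \<le> e"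
    using Linf_simple_approx[OF space_closed h e] by blast
  have st: "simple (\<lambda>\<omega>. a * s \<omega> + t \<omega>)"
    using s(1) t(1) by (rule simple_function_compose2)
  have tri: "\<bar>(a * x + y) - (a * x' + y')\<bar> \<le> \<bar>a\<bar> * e + e" if "\<bar>x - x'\<bar> \<le> e" "\<bar>y - y'\<bar> \<le> e" for x x' y y'
  proof -
    have "\<bar>(a * x + y) - (a * x' + y')\<bar> = \<bar>a * (x - x') + (y - y')\<bar>" by (simp add: algebra_simps)
    also have "\<dots> \<le> \<bar>a\<bar> * \<bar>x - x'\<bar> + \<bar>y - y'\<bar>" by (metis abs_mult abs_triangle_ineq)
    also have "\<dots> \<le> \<bar>a\<bar> * e + e" using that by (intro add_mono mult_left_mono) auto
    finally show ?thesis .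
  qed
  have "\<bar>fa_integral \<Omega> F p (fun_scale a f + h) - fa_simple_integral \<Omega> p (\<lambda>\<omega>. a * s \<omega> + t \<omega>)\<bar>
      \<le> \<bar>a\<bar> * e + e"
    using tri[OF s(2) t(2)] by (intro fa_integral_approx st) (simp add: fun_scale_def)
  moreover note simple_integral_linear[OF s(1) t(1), of a]
    tri[OF fa_integral_approx[OF s] fa_integral_approx[OF t]]
  ultimately show "\<bar>fa_integral \<Omega> F p (fun_scale a f + h)
      - (a * fa_integral \<Omega> F p f + fa_integral \<Omega> F p h)\<bar> \<le> (2 * (\<bar>a\<bar> + 1)) * e"
    by (simp add: distrib_right)
qed

lemma fa_integral_positive_functional:
  "positive_functional \<Omega> (Linf \<Omega> F) (fa_integral \<Omega> F p)"
proof
  note lin = fa_integral_linear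
  \<comment> \<open>The constant function approximates \<open>f\<close> on \<Omega> with error
    0.\<close>
  have const: "fa_integral \<Omega> F p f = c" if "\<And>\<omega>. \<omega> \<in> \<Omega> \<Longrightarrow> f \<omega> = c" for f c
    using fa_integral_approx[of "\<lambda>_. c" f 0] that simple_integral_const by simp
  have zero: "0 \<in> Linf \<Omega> F" by (rule real_fun.subspace_0[OF subspace_Linf])
  show "real_fun.subspace (Linf \<Omega> F)" by (rule subspace_Linf)
  show "indicator \<Omega> \<in> Linf \<Omega> F" by (rule indicator_in_Linf[OF sigma_algebra_axioms top])
  show "fa_integral \<Omega> F p (indicator \<Omega>) = 1" by (rule const) simp
  show "fa_integral \<Omega> F p (f + h) = fa_integral \<Omega> F p f + fa_integral \<Omega> F p h"
    if "f \<in> Linf \<Omega> F" "h \<in> Linf \<Omega> F" for f h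
    using lin[OF that, of 1] by simp
  show "fa_integral \<Omega> F p (fun_scale c f) = c * fa_integral \<Omega> F p f" if "f \<in> Linf \<Omega> F" for f c
    using lin[OF that zero, of c] const[of 0 0] by simp
  show "0 \<le> fa_integral \<Omega> F p f" if f: "f \<in> Linf \<Omega> F" and nn: "\<And>\<omega>. \<omega> \<in> \<Omega> \<Longrightarrow> 0 \<le> f \<omega>" for f
  proof (rule field_le_epsilon)
    fix e :: real assume e: "e > 0"
    \<comment> \<open>Half of \<open>e\<close> allows for negative values of \<open>s\<close>, the
      other half for the approximation error of the integral.\<close>
    obtain s where s: "simple s" "\<And>\<omega>. \<omega> \<in> \<Omega> \<Longrightarrow> \<bar>f \<omega> - s \<omega>\<bar> \<le> e / 2"
      using Linf_simple_approx[OF space_closed f, of "e / 2"] e by auto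
    have "- (e / 2) \<le> s \<omega>" if "\<omega> \<in> \<Omega>" for \<omega>
      using s(2)[OF that] nn[OF that] by linarith
    then have "- (e / 2) \<le> fa_simple_integral \<Omega> p s"
      using simple_integral_mono[OF simple_function_const s(1), of "- (e / 2)"]
      by (simp add: simple_integral_const)
    with fa_integral_approx[OF s] show "0 \<le> fa_integral \<Omega> F p f + e" by linarith
  qed
qed

end

text \<open>The values on indicators determine \<open>p\<close>, and linearity of \<open>E\<close>
  makes it additive. On simple functions in \<open>Linf \<Omega> F\<close> the integral and
  \<open>E\<close> agree; both are nonexpansive under uniform approximation, so they agree
  everywhere on \<open>Linf \<Omega> F\<close>.\<close>

lemma positive_functional_representation:
  assumes F: "sigma_algebra \<Omega> F" and E: "positive_functional \<Omega> (Linf \<Omega> F) E"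
  defines "p \<equiv> \<lambda>A. E (indicator A)"
  shows "p \<in> fa_prob \<Omega> F" and "f \<in> Linf \<Omega> F \<Longrightarrow> fa_integral \<Omega> F p f = E f"
proof -
  interpret sigma_algebra \<Omega> F by fact
  interpret E: positive_functional \<Omega> "Linf \<Omega> F" E by fact
  note ind = indicator_in_Linf[OF F]
  have "additive F p"
    unfolding additive_def
  proof (intro ballI impI)
    fix A B assume AB: "A \<in> F" "B \<in> F" "A \<inter> B = {}"
    then have "indicator (A \<union> B) = indicator A + (indicator B :: _ \<Rightarrow> real)"
      by (auto simp: indicator_def fun_eq_iff)
    then show "p (A \<union> B) = p A + p B" using AB by (simp add: p_def E.add ind)
  qed
  then show p: "p \<in> fa_prob \<Omega> F"
    using E.one E.nonneg[OF ind] by (auto simp: fa_prob_def p_def)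
  interpret fa_prob_space \<Omega> F p by unfold_locales (rule p)
  assume f: "f \<in> Linf \<Omega> F"
  show "fa_integral \<Omega> F p f = E f"
  proof (rule eq_if_abs_diff_le_multiple)
    fix e :: real assume e: "e > 0"
    obtain s where s: "simple s" "s \<in> Linf \<Omega> F" "\<And>\<omega>. \<omega> \<in> \<Omega> \<Longrightarrow> \<bar>f \<omega> - s \<omega>\<bar> \<le> e"
      using Linf_simple_approx[OF space_closed f e] by blast
    \<comment> \<open>The decomposition into level sets holds on the whole type, because
      \<open>s\<close> vanishes off \<Omega>.\<close>
    have "s = (\<Sum>x\<in>s ` \<Omega>. fun_scale x (indicator (s -` {x} \<inter> \<Omega>)))"
    proof
      fix \<omega>
      have "(\<Sum>x\<in>s ` \<Omega>. fun_scale x (indicator (s -` {x} \<inter> \<Omega>))) \<omega>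
          = (\<Sum>x\<in>s ` \<Omega>. if x = s \<omega> \<and> \<omega> \<in> \<Omega> then x else 0)"
        unfolding sum_fun_scale_family_apply by (intro sum.cong) (auto simp: indicator_def)
      also have "\<dots> = s \<omega>"
        using s(1,2) by (cases "\<omega> \<in> \<Omega>") (auto simp: simple_iff Linf_def)
      finally show "s \<omega> = (\<Sum>x\<in>s ` \<Omega>. fun_scale x (indicator (s -` {x} \<inter> \<Omega>))) \<omega>" by simp
    qed
    then have "E s = E (\<Sum>x\<in>s ` \<Omega>. fun_scale x (indicator (s -` {x} \<inter> \<Omega>)))" by simp
    also have "\<dots> = fa_simple_integral \<Omega> p s"
      unfolding fa_simple_integral_def p_def
      by (rule E.sum) (use s(1) in \<open>auto simp: simple_iff intro!: ind\<close>)
    finally have "E s = fa_simple_integral \<Omega> p s" .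
    with fa_integral_approx[OF s(1,3)] E.abs_diff_le[OF f s(2,3)]
    show "\<bar>fa_integral \<Omega> F p f - E f\<bar> \<le> 2 * e" by linarith
  qed
qed

section \<open>Pricing measures\<close>

text \<open>By linearity the integral agrees with the linear extension on the whole span, and
  monotonicity compares it there with its value at \<open>g\<close>.\<close>

lemma pricing_measure_price_bounds:
  assumes F: "sigma_algebra \<Omega> F" and HL: "H \<subseteq> Linf \<Omega> F" and c: "coherent \<Omega> H \<pi>"
    and g: "g \<in> Linf \<Omega> F" and pM: "p \<in> pricing_measures \<Omega> F H \<pi>"
  shows "lower_price \<Omega> (real_fun.span H) (linear_extension H \<pi>) g \<le> ereal (fa_integral \<Omega> F p g)"
    and "ereal (fa_integral \<Omega> F p g) \<le> upper_price \<Omega> (real_fun.span H) (linear_extension H \<pi>) g"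
proof -
  interpret sigma_algebra \<Omega> F by fact
  interpret fa_prob_space \<Omega> F p
    by unfold_locales (use pM in \<open>simp add: pricing_measures_def\<close>)
  interpret I: positive_functional \<Omega> "Linf \<Omega> F" "fa_integral \<Omega> F p"
    by (rule fa_integral_positive_functional)
  have V: "f \<in> Linf \<Omega> F" if "f \<in> real_fun.span H" for f
    using real_fun.span_minimal[OF HL subspace_Linf] that by blast
  have eq: "linear_extension H \<pi> f = fa_integral \<Omega> F p f" if f: "f \<in> real_fun.span H" for f
  proof -
    obtain t r where t: "finite t" "t \<subseteq> H" "f = (\<Sum>h\<in>t. fun_scale (r h) h)"
      using f unfolding real_fun.span_explicit by blast
    have "fa_integral \<Omega> F p f = (\<Sum>h\<in>t. r h * fa_integral \<Omega> F p h)"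
      unfolding t(3) using t(2) HL by (intro I.sum) auto
    also have "\<dots> = (\<Sum>h\<in>t. r h * \<pi> h)"
    proof (rule sum.cong)
      fix h assume "h \<in> t"
      then have "h \<in> H" using t(2) by blast
      then have "fa_integral \<Omega> F p h = \<pi> h"
        using pM unfolding pricing_measures_def by blast
      then show "r h * fa_integral \<Omega> F p h = r h * \<pi> h" by (rule arg_cong)
    qed simp
    finally show ?thesis unfolding t(3) linear_extension_eq[OF c t(1,2)] by simp
  qed
  show "lower_price \<Omega> (real_fun.span H) (linear_extension H \<pi>) g \<le> ereal (fa_integral \<Omega> F p g)"
    unfolding lower_price_def using I.mono[OF V g] by (intro SUP_least) (auto simp: eq)
  show "ereal (fa_integral \<Omega> F p g) \<le> upper_price \<Omega> (real_fun.span H) (linear_extension H \<pi>) g"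
    unfolding upper_price_def using I.mono[OF g V] by (intro INF_greatest) (auto simp: eq)
qed

text \<open>Every admissible price is realised: assign \<open>x\<close> to \<open>g\<close>, extend
  positively to all of \<open>Linf \<Omega> F\<close>, and evaluate the resulting functional on
  indicators.\<close>

lemma pricing_measure_exists:
  assumes F: "sigma_algebra \<Omega> F" and HL: "H \<subseteq> Linf \<Omega> F" and one: "indicator \<Omega> \<in> H"
    and c: "coherent \<Omega> H \<pi>" and g: "g \<in> Linf \<Omega> F - real_fun.span H"
    and x: "lower_price \<Omega> (real_fun.span H) (linear_extension H \<pi>) g \<le> ereal x"
      "ereal x \<le> upper_price \<Omega> (real_fun.span H) (linear_extension H \<pi>) g"
  obtains p where "p \<in> pricing_measures \<Omega> F H \<pi>" "fa_integral \<Omega> F p g = x"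
proof -
  let ?V = "real_fun.span H" and ?L = "linear_extension H \<pi>"
  interpret L: positive_functional \<Omega> ?V ?L
    using c one by (rule linear_extension_positive_functional)
  let ?W = "real_fun.span (insert g ?V)" and ?P = "price_extension ?V ?L g x"
  interpret P: positive_functional \<Omega> ?W ?P
    using L.price_extension_positive_iff g x by blast
  have V: "?V \<subseteq> Linf \<Omega> F" by (rule real_fun.span_minimal[OF HL subspace_Linf])
  have W: "?W \<subseteq> Linf \<Omega> F"
    using V g by (intro real_fun.span_minimal subspace_Linf) auto
  obtain E where E: "positive_functional \<Omega> (Linf \<Omega> F) E" "\<And>f. f \<in> ?W \<Longrightarrow> E f = ?P f"
    using P.extend_to_bounded[OF W subspace_Linf] by (auto simp: Linf_def)
  note rep = positive_functional_representation[OF F E(1)]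
  note eq = price_extension_eq[OF L.subspace, of g _ ?L x]
  have "E h = \<pi> h" if h: "h \<in> H" for h
  proof -
    have hV: "h \<in> ?V" using h by (rule real_fun.span_base)
    have "E h = ?P h" using hV by (intro E(2) real_fun.span_base) auto
    then show ?thesis using eq[OF _ hV, of 0] g linear_extension_base[OF c h] by simp
  qed
  moreover have "E g = ?P g" by (intro E(2) real_fun.span_base) auto
  then have "E g = x"
    using eq[OF _ real_fun.span_zero[of H], of 1] g L.const[of 0] by simp
  ultimately show ?thesis
    using rep HL g by (intro that[of "\<lambda>A. E (indicator A)"]) (auto simp: pricing_measures_def)
qed

theorem theorem3p6:
  fixes \<Omega> :: "'a set" and F :: "'a set set" and H :: "('a \<Rightarrow> real) set"
    and \<pi> :: "('a \<Rightarrow> real) \<Rightarrow> real" and g :: "'a \<Rightarrow> real" and g0 :: real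
  assumes "sigma_algebra \<Omega> F"
    and "H \<subseteq> Linf \<Omega> F"
    and "indicator \<Omega> \<in> H"
    and "coherent \<Omega> H \<pi>"
    and "g \<in> Linf \<Omega> F - real_fun.span H"
  shows "(coherent \<Omega> (real_fun.span (H \<union> {g}))
            (price_extension (real_fun.span H) (linear_extension H \<pi>) g g0)
          \<longleftrightarrow> ereal g0 \<in> {lower_price \<Omega> (real_fun.span H) (linear_extension H \<pi>) g ..
                            upper_price \<Omega> (real_fun.span H) (linear_extension H \<pi>) g})
       \<and> lower_price \<Omega> (real_fun.span H) (linear_extension H \<pi>) g
           = (INF p\<in>pricing_measures \<Omega> F H \<pi>. ereal (fa_integral \<Omega> F p g))
       \<and> upper_price \<Omega> (real_fun.span H) (linear_extension H \<pi>) g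
           = (SUP p\<in>pricing_measures \<Omega> F H \<pi>. ereal (fa_integral \<Omega> F p g))"
proof -
  let ?V = "real_fun.span H" and ?L = "linear_extension H \<pi>"
  interpret L: positive_functional \<Omega> ?V ?L
    using assms(4,3) by (rule linear_extension_positive_functional)
  have g: "g \<in> Linf \<Omega> F" "g \<notin> ?V" using assms(5) by auto
  interpret P: normalized_functional \<Omega> "real_fun.span (insert g ?V)" "price_extension ?V ?L g g0"
    by (rule L.price_extension_normalized_functional[OF g(2)])
  \<comment> \<open>Adjoining \<open>g\<close> before or after forming the span yields the same
    space, on which coherence is positivity.\<close>
  have "real_fun.span (H \<union> {g}) = real_fun.span (insert g ?V)"
    by (simp add: real_fun.span_insert real_fun.span_span)
  then have "coherent \<Omega> (real_fun.span (H \<union> {g})) (price_extension ?V ?L g g0)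
      \<longleftrightarrow> ereal g0 \<in> {lower_price \<Omega> ?V ?L g .. upper_price \<Omega> ?V ?L g}"
    using P.coherent_iff_positive[OF coherent_nonempty[OF assms(4)]]
      L.price_extension_positive_iff[OF g(2), of g0] by simp
  moreover obtain l u where lu: "lower_price \<Omega> ?V ?L g = ereal l" "upper_price \<Omega> ?V ?L g = ereal u"
      "l \<le> u"
    using L.prices_finite[of g] g(1) by (auto simp: Linf_def)
  \<comment> \<open>Both end points are admissible prices themselves, so measures \<open>p\<close>
    and \<open>q\<close> attain them; the infimum and the supremum are a minimum and a
    maximum.\<close>
  obtain p where p: "p \<in> pricing_measures \<Omega> F H \<pi>" "fa_integral \<Omega> F p g = l"
    using pricing_measure_exists[OF assms, of l] lu by auto
  obtain q where q: "q \<in> pricing_measures \<Omega> F H \<pi>" "fa_integral \<Omega> F q g = u"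
    using pricing_measure_exists[OF assms, of u] lu by auto
  note bounds = pricing_measure_price_bounds[OF assms(1,2,4) g(1)]
  have "lower_price \<Omega> ?V ?L g = (INF p\<in>pricing_measures \<Omega> F H \<pi>. ereal (fa_integral \<Omega> F p g))"
    using p bounds(1) lu by (intro antisym INF_greatest INF_lower2[of p]) auto
  moreover have "upper_price \<Omega> ?V ?L g = (SUP p\<in>pricing_measures \<Omega> F H \<pi>. ereal (fa_integral \<Omega> F p g))"
    using q bounds(2) lu by (intro antisym SUP_least SUP_upper2[of q]) auto
  ultimately show ?thesis by blast
qed

end
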